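(* For the weighted projective space $X=\mathbb{P}(1,\dots,1,a,b)$ (with $r$ weights, the first $r-2$ of which equal $1$, and $w_{r-1}=a$, $w_r=b$), the vanishing ideal $I(X(\mathbb{F}_q))$ is generated by the following binomials: $$\begin{aligned} &x_ix_j(x_i^{q-1}-x_j^{q-1}) &&\text{for }1\le i<j<r-1,\\ &x_kx_{r-1}(x_k^{(q-1)a}-x_{r-1}^{q-1}) &&\text{for }1\le k<r-1,\\ &x_kx_r(x_k^{(q-1)b}-x_r^{q-1}) &&\text{for }1\le k<r-1,\\ &x_{r-1}x_r(x_{r-1}^{(q-1)b}-x_r^{(q-1)a}). \end{aligned}$$
   Context: $\mathbb{F}_q$ is a finite field, $\mathbb{K}=\overline{\mathbb{F}}_q$ an algebraic closure. Let $w_1,\dots,w_r$ be positive integers such that any $r-1$ of them have no nontrivial common divisor, i.e. $\gcd(w_1,\dots,\widehat{w_i},\dots,w_r)=1$ for every $i\in\{1,\dots,r\}$. $S=\mathbb{F}_q[x_1,\dots,x_r]$ is graded by $\deg(x_i)=w_i$; "homogeneous" refers to this grading. The group $G=\{(t^{w_1},\dots,t^{w_r}):t\in\mathbb{K}^*\}$ acts on $\mathbb{K}^r$ by coordinatewise multiplication. The weighted projective space is $X=\mathbb{P}(w_1,\dots,w_r)=(\mathbb{K}^r\setminus\{0\})/G$, and $X(\mathbb{F}_q)$ is identified with the set of $G$-orbits of points of $\mathbb{F}_q^r\setminus\{0\}$. $I(X(\mathbb{F}_q))\subseteq S$ is the ideal generated by the homogeneous polynomials in $S$ vanishing at all points of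 $\mathbb{F}_q^r\setminus\{0\}$. In the theorem $r\ge3$, $w_i=1$ for $i\in\{1,\dots,r-2\}$, and $w_{r-1}=a$, $w_r=b$ are positive integers.
   Formalization: The formal theorem additionally assumes gcd(a,b)=1: for r≥4 the weight condition permits d=gcd(a,b)>1, and then x_{r-1}x_r(x_{r-1}^{(q-1)b/d}-x_r^{(q-1)a/d}) lies in the vanishing ideal but not in the ideal of the listed binomials. *)

theory Defs
  imports "HOL-Algebra.Ideal" "HOL-Library.Poly_Mapping" "HOL-Library.Cardinality"
begin

text \<open>
  A polynomial is a finitely supported map from exponent vectors to coefficients; the type itself
  has a variable for every natural number, and \<open>poly_ring r\<close> below cuts it down to
  \<open>x\<^sub>1, \<dots>, x\<^sub>r\<close>.
\<close>

type_synonym 'k npoly = "(nat \<Rightarrow>\<^sub>0 nat) \<Rightarrow>\<^sub>0 'k"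

definition var :: "nat \<Rightarrow> 'k::comm_ring_1 npoly" where
  "var i = Poly_Mapping.single (Poly_Mapping.single i 1) 1"

definition poly_ring :: "nat \<Rightarrow> 'k::comm_ring_1 npoly ring" where
  "poly_ring r =
     \<lparr>carrier = {p. \<forall>m \<in> Poly_Mapping.keys p. Poly_Mapping.keys m \<subseteq> {1..r}},
      mult = (*), one = 1, zero = 0, add = (+)\<rparr>"

lemma poly_ring_cring: "cring (poly_ring r :: 'k::comm_ring_1 npoly ring)"
proof -
  let ?C = "{p :: 'k npoly. \<forall>m \<in> Poly_Mapping.keys p. Poly_Mapping.keys m \<subseteq> {1..r}}"
  have add: "p + q \<in> ?C" if "p \<in> ?C" "q \<in> ?C" for p q
    using that keys_add[of p q] by blast
  have mult: "p * q \<in> ?C" if "p \<in> ?C" "q \<in> ?C" for p q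
  proof (intro CollectI ballI)
    fix m assume "m \<in> Poly_Mapping.keys (p * q)"
    then obtain m1 m2 where "m = m1 + m2" "m1 \<in> Poly_Mapping.keys p" "m2 \<in> Poly_Mapping.keys q"
      using keys_mult[of p q] by blast
    then show "Poly_Mapping.keys m \<subseteq> {1..r}"
      using that keys_add[of m1 m2] by blast
  qed
  have minus: "- p \<in> ?C" if "p \<in> ?C" for p
    using that by (auto simp: in_keys_iff)
  have zero: "0 \<in> ?C" and one: "1 \<in> ?C"
    by simp_all
  show ?thesis
  proof (rule cringI)
    show "abelian_group (poly_ring r :: 'k npoly ring)"
    proof (rule abelian_groupI, unfold poly_ring_def ring.simps partial_object.simps monoid.simps)
      show "\<exists>q\<in>?C. q + p = 0" if "p \<in> ?C" for p
        using minus[OF that] by (rule bexI[rotated]) simp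
    qed ((rule add zero add.assoc add.commute add_0_left; assumption)+)
    show "comm_monoid (poly_ring r :: 'k npoly ring)"
      by (rule comm_monoidI, unfold poly_ring_def ring.simps partial_object.simps monoid.simps)
        (rule mult one mult.assoc mult.commute mult_1_left; assumption)+
  qed (simp add: poly_ring_def distrib_right)
qed

definition weighted_degree :: "(nat \<Rightarrow> nat) \<Rightarrow> (nat \<Rightarrow>\<^sub>0 nat) \<Rightarrow> nat" where
  "weighted_degree w m = (\<Sum>i \<in> Poly_Mapping.keys m. w i * Poly_Mapping.lookup m i)"

definition homogeneous :: "(nat \<Rightarrow> nat) \<Rightarrow> 'k::comm_ring_1 npoly \<Rightarrow> bool" where
  "homogeneous w p \<longleftrightarrow> (\<exists>d. \<forall>m \<in> Poly_Mapping.keys p. weighted_degree w m = d)"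

definition eval_poly :: "(nat \<Rightarrow> 'k) \<Rightarrow> 'k::comm_ring_1 npoly \<Rightarrow> 'k" where
  "eval_poly v p =
     (\<Sum>m \<in> Poly_Mapping.keys p.
        Poly_Mapping.lookup p m * (\<Prod>i \<in> Poly_Mapping.keys m. v i ^ Poly_Mapping.lookup m i))"

text \<open>
  \<open>nonzero_points r\<close> is \<open>k\<^sup>r\<close> minus the origin. Every rational point of the weighted projective
  space over a finite field \<open>k\<close> is the orbit of such a point, and a homogeneous polynomial vanishes
  on all of an orbit or nowhere on it, so that the vanishing ideal is described by these
  representatives.
\<close>

definition nonzero_points :: "nat \<Rightarrow> (nat \<Rightarrow> 'k::zero) set" where
  "nonzero_points r = ({1..r} \<rightarrow>\<^sub>E UNIV) - {\<lambda>i\<in>{1..r}. 0}"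

definition vanishing_ideal :: "nat \<Rightarrow> (nat \<Rightarrow> nat) \<Rightarrow> 'k::comm_ring_1 npoly set" where
  "vanishing_ideal r w =
     Idl\<^bsub>poly_ring r\<^esub>
       {p \<in> carrier (poly_ring r). homogeneous w p \<and> (\<forall>v \<in> nonzero_points r. eval_poly v p = 0)}"

definition well_formed_weights :: "nat \<Rightarrow> (nat \<Rightarrow> nat) \<Rightarrow> bool" where
  "well_formed_weights r w \<longleftrightarrow>
     (\<forall>i \<in> {1..r}. w i > 0) \<and> (\<forall>i \<in> {1..r}. Gcd (w ` ({1..r} - {i})) = 1)"

end

theory Submission
  imports Defs "HOL-Computational_Algebra.Polynomial"
begin

text \<open>
  Over a field with \<open>q\<close> elements, two monomials define the same function on \<open>k\<^sup>r\<close> as soon as they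
  have the same variables and exponents congruent modulo \<open>q - 1\<close>, and monomials whose exponents
  are all less than \<open>q\<close> are linearly independent as functions. So a polynomial that vanishes
  everywhere is a combination of differences of monomials of the former kind, and for a homogeneous
  polynomial the two monomials also have the same weighted degree. The given binomials suffice to
  connect them. If a variable of weight 1 occurs, all other exponents can be shifted into it
  in steps of \<open>q - 1\<close>. If the support is \<open>{r - 1, r}\<close>, equality of the degrees and coprimality of
  \<open>a\<close> and \<open>b\<close> force the exponents to differ by multiples of \<open>(q - 1) * b\<close> and \<open>(q - 1) * a\<close>. If
  there is just one variable, the degree determines the exponent.
\<close>

subsection \<open>Functions on a finite field\<close>

lemma two_le_card_field: "2 \<le> CARD('k::{field,finite})"
proof -
  have "card {0, 1 :: 'k} \<le> CARD('k)"
    by (intro card_mono) auto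
  then show ?thesis by simp
qed

text \<open>Multiplication by \<open>x\<close> permutes the nonzero elements, so it leaves their
  product unchanged while multiplying it by the power of \<open>x\<close>; the product is nonzero
  and cancels.\<close>

lemma finite_field_power_card_minus_1:
  fixes x :: "'k::{field,finite}"
  assumes "x \<noteq> 0"
  shows "x ^ (CARD('k) - 1) = 1"
proof -
  let ?U = "UNIV - {0 :: 'k}"
  have "bij_betw ((*) x) ?U ?U"
    by (rule bij_betw_byWitness[where f' = "\<lambda>y. y / x"]) (use assms in auto)
  then have "(\<Prod>y\<in>?U. x * y) = \<Prod>?U"
    by (rule prod.reindex_bij_betw)
  then have "x ^ card ?U * \<Prod>?U = \<Prod>?U"
    by (simp add: prod.distrib)
  moreover have "\<Prod>?U \<noteq> 0"
    by simp
  moreover have "card ?U = CARD('k) - 1"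
    by (simp add: card_Diff_singleton)
  ultimately show ?thesis by simp
qed

text \<open>For \<open>q\<close> at least 2, a positive exponent goes to its representative modulo
  \<open>q - 1\<close> in the range from 1 to \<open>q - 1\<close>. Zero stays apart because
  \<open>x ^ 0\<close> and \<open>x ^ (q - 1)\<close> differ at \<open>x = 0\<close>.\<close>

definition reduced_exponent :: "nat \<Rightarrow> nat \<Rightarrow> nat" where
  "reduced_exponent q e = (if e = 0 then 0 else Suc ((e - 1) mod (q - 1)))"

lemma reduced_exponent_less:
  assumes "2 \<le> q"
  shows "reduced_exponent q e < q"
proof -
  have "(e - 1) mod (q - 1) < q - 1"
    using assms by (intro mod_less_divisor) simp
  then show ?thesis
    using assms unfolding reduced_exponent_def by (smt (verit) Suc_leI less_diff_conv less_le_trans pos2 plus_1_eq_Suc add.commute)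
qed

lemma reduced_exponent_0_iff: "reduced_exponent q e = 0 \<longleftrightarrow> e = 0"
  by (simp add: reduced_exponent_def)

lemma reduced_exponent_eqD:
  assumes "reduced_exponent q e = reduced_exponent q e'" "e' \<le> e"
  obtains u where "e = e' + (q - 1) * u"
proof (cases "e' = 0")
  case True
  with assms have "e = e' + (q - 1) * 0"
    by (auto simp: reduced_exponent_def split: if_splits)
  then show ?thesis ..
next
  case False
  with assms have eq: "(e - 1) mod (q - 1) = (e' - 1) mod (q - 1)"
    by (auto simp: reduced_exponent_def split: if_splits)
  have "e' - 1 \<le> e - 1"
    using assms by simp
  then obtain u where "e - 1 = e' - 1 + (q - 1) * u"
    using eq by (metis mod_eq_nat1E)
  then have "e = e' + (q - 1) * u"
    using False assms by simp
  then show ?thesis ..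
qed

text \<open>For nonzero \<open>x\<close> exponents matter only modulo \<open>q - 1\<close>. At
  \<open>x = 0\<close> a power depends only on whether its exponent is zero, which reduction
  preserves.\<close>

lemma power_reduced_exponent:
  fixes x :: "'k::{field,finite}"
  shows "x ^ reduced_exponent (CARD('k)) e = x ^ e"
proof (cases "e = 0 \<or> x = 0")
  case True
  then show ?thesis by (auto simp: reduced_exponent_def)
next
  case False
  let ?n = "CARD('k) - 1"
  have "x ^ e = x ^ (Suc ((e - 1) mod ?n) + ?n * ((e - 1) div ?n))"
    using False by simp
  also have "\<dots> = x ^ Suc ((e - 1) mod ?n)"
    using False finite_field_power_card_minus_1[of x]
    by (simp only: power_add power_mult power_one mult_1_right de_Morgan_disj not_False_eq_True)
  finally show ?thesis
    using False by (simp add: reduced_exponent_def)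
qed

text \<open>A polynomial of degree less than \<open>q\<close> with all \<open>q\<close> field
  elements as roots is zero.\<close>

lemma univariate_coeffs_eq_0:
  fixes c :: "nat \<Rightarrow> 'k::{field,finite}"
  assumes "\<And>x. (\<Sum>n<CARD('k). c n * x ^ n) = 0" and "n < CARD('k)"
  shows "c n = 0"
proof -
  define p where "p = (\<Sum>n<CARD('k). monom (c n) n)"
  have "poly p x = 0" for x
    using assms(1)[of x] by (simp add: p_def poly_sum poly_monom)
  then have roots: "{x. poly p x = 0} = UNIV"
    by auto
  have "degree p < CARD('k)"
    unfolding p_def
    by (rule degree_sum_less) (auto intro: le_less_trans[OF degree_monom_le])
  then have "p = 0"
    using card_poly_roots_bound[of p] roots by fastforce
  then have "coeff p n = 0" by simp
  then show ?thesis
    using assms(2) by (simp add: p_def coeff_sum)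
qed

text \<open>Induction on the set of variables: with the other coordinates fixed, the sum is a
  univariate polynomial in the coordinate \<open>j\<close>, and each of its coefficients vanishes.
  Such a coefficient is a sum of the same kind over fewer variables. Indexing by \<open>M\<close>,
  with exponents given by \<open>e\<close>, lets the induction pass to subsets of
  \<open>M\<close>.\<close>

lemma reduced_monomials_independent:
  fixes c :: "'i \<Rightarrow> 'k::{field,finite}" and e :: "'i \<Rightarrow> 'v \<Rightarrow> nat"
  assumes "finite I" and "finite M"
    and "\<And>m m'. m \<in> M \<Longrightarrow> m' \<in> M \<Longrightarrow> (\<And>i. i \<in> I \<Longrightarrow> e m i = e m' i) \<Longrightarrow> m = m'"
    and "\<And>m i. m \<in> M \<Longrightarrow> i \<in> I \<Longrightarrow> e m i < CARD('k)"
    and "\<And>v :: 'v \<Rightarrow> 'k. (\<Sum>m\<in>M. c m * (\<Prod>i\<in>I. v i ^ e m i)) = 0"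
    and "m \<in> M"
  shows "c m = 0"
  using assms
proof (induction I arbitrary: M m rule: finite_induct)
  case empty
  then have "M = {m}"
    by blast
  then show ?case
    using empty.prems(4) by simp
next
  case (insert j I)
  \<comment> \<open>These are the indices that contribute to the coefficient of the
    \<open>n\<close>-th power of the coordinate \<open>j\<close>. Inside one such set the exponent
    at \<open>j\<close> is constant, so the variables in \<open>I\<close> alone still tell its
    members apart.\<close>
  define N where "N n = {m \<in> M. e m j = n}" for n
  have "(\<Sum>m\<in>N n. c m * (\<Prod>i\<in>I. v i ^ e m i)) = 0" if "n < CARD('k)" for n and v :: "'v \<Rightarrow> 'k"
  proof (rule univariate_coeffs_eq_0[OF _ that])
    fix x :: 'k
    let ?v = "v(j := x)"
    have "(\<Sum>n<CARD('k). (\<Sum>m\<in>N n. c m * (\<Prod>i\<in>I. v i ^ e m i)) * x ^ n) =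
          (\<Sum>n<CARD('k). \<Sum>m\<in>N n. c m * (\<Prod>i\<in>insert j I. ?v i ^ e m i))"
    proof (intro sum.cong refl, unfold sum_distrib_right, intro sum.cong refl)
      fix n m assume "m \<in> N n"
      moreover have "(\<Prod>i\<in>I. ?v i ^ e m i) = (\<Prod>i\<in>I. v i ^ e m i)"
        using insert.hyps by (intro prod.cong) auto
      ultimately show "c m * (\<Prod>i\<in>I. v i ^ e m i) * x ^ n = c m * (\<Prod>i\<in>insert j I. ?v i ^ e m i)"
        using insert.hyps by (simp add: N_def mult_ac)
    qed
    also have "\<dots> = (\<Sum>m\<in>M. c m * (\<Prod>i\<in>insert j I. ?v i ^ e m i))"
      unfolding N_def using insert.prems(1,3) by (intro sum.group) auto
    also have "\<dots> = 0"
      by (rule insert.prems)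
    finally show "(\<Sum>n<CARD('k). (\<Sum>m\<in>N n. c m * (\<Prod>i\<in>I. v i ^ e m i)) * x ^ n) = 0" .
  qed
  moreover have "e m j < CARD('k)" "m \<in> N (e m j)"
    using insert.prems by (auto simp: N_def)
  moreover have "m1 = m2"
    if "m1 \<in> N (e m j)" "m2 \<in> N (e m j)" "\<And>i. i \<in> I \<Longrightarrow> e m1 i = e m2 i" for m1 m2
    using that by (intro insert.prems(2)) (auto simp: N_def)
  ultimately show ?case
    using insert.prems(1,3) by (intro insert.IH[of "N (e m j)"]) (auto simp: N_def)
qed

lemma reduced_exponent_add:
  assumes "0 < e"
  shows "reduced_exponent q (e + (q - 1) * u) = reduced_exponent q e"
proof -
  have "e + (q - 1) * u - 1 = e - 1 + (q - 1) * u"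
    using assms by simp
  then show ?thesis
    using assms unfolding reduced_exponent_def by (metis add_is_0 less_irrefl mod_mult_self2)
qed

lemma reduced_exponent_id: "e < q \<Longrightarrow> reduced_exponent q e = e"
  by (auto simp: reduced_exponent_def)

subsection \<open>Monomials, weighted degree and evaluation\<close>

abbreviation monomial :: "(nat \<Rightarrow>\<^sub>0 nat) \<Rightarrow> 'k::comm_ring_1 npoly" where
  "monomial m \<equiv> Poly_Mapping.single m 1"

lemma var_power: "var i ^ n = (monomial (Poly_Mapping.single i n) :: 'k::comm_ring_1 npoly)"
proof (induction n)
  case (Suc n)
  then show ?case
    by (simp add: var_def mult_single flip: single_add)
qed simp

text \<open>All four families of generators have this shape, so each generator can be read as a
  congruence between two monomials.\<close>

lemma binomial_eq:
  "var i * var j * (var i ^ s - var j ^ t) =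
     (monomial (Poly_Mapping.single i (Suc s) + Poly_Mapping.single j 1)
      - monomial (Poly_Mapping.single i 1 + Poly_Mapping.single j (Suc t)) :: 'k::comm_ring_1 npoly)"
proof -
  have "var i * var j * (var i ^ s - var j ^ t) =
    (var i ^ Suc s * var j ^ 1 - var i ^ 1 * var j ^ Suc t :: 'k npoly)"
    by (simp add: algebra_simps)
  then show ?thesis
    by (simp only: var_power mult_single mult_1_left)
qed

lemma poly_mapping_sum_single:
  fixes p :: "'a \<Rightarrow>\<^sub>0 'b::comm_monoid_add"
  shows "p = (\<Sum>m\<in>Poly_Mapping.keys p. Poly_Mapping.single m (Poly_Mapping.lookup p m))"
  by (rule poly_mapping_eqI)
    (auto simp: lookup_sum lookup_single when_def in_keys_iff)

lemma weighted_degree_superset: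
  assumes "finite I" "Poly_Mapping.keys m \<subseteq> I"
  shows "weighted_degree w m = (\<Sum>i\<in>I. w i * Poly_Mapping.lookup m i)"
  unfolding weighted_degree_def using assms
  by (intro sum.mono_neutral_left) (auto simp: in_keys_iff)

lemma weighted_degree_add: "weighted_degree w (m + n) = weighted_degree w m + weighted_degree w n"
proof -
  let ?I = "Poly_Mapping.keys m \<union> Poly_Mapping.keys n"
  have "finite ?I" "Poly_Mapping.keys (m + n) \<subseteq> ?I"
    using keys_add[of m n] by auto
  then show ?thesis
    using weighted_degree_superset[of ?I] by (simp add: lookup_add distrib_left sum.distrib)
qed

lemma weighted_degree_single: "weighted_degree w (Poly_Mapping.single i n) = w i * n"
  by (simp add: weighted_degree_def)

lemma monomial_value_superset:
  assumes "finite I" "Poly_Mapping.keys m \<subseteq> I"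
  shows "(\<Prod>i\<in>Poly_Mapping.keys m. v i ^ Poly_Mapping.lookup m i) =
    (\<Prod>i\<in>I. (v i :: 'k::comm_ring_1) ^ Poly_Mapping.lookup m i)"
  using assms by (intro prod.mono_neutral_left) (auto simp: in_keys_iff)

lemma eval_poly_superset:
  assumes "finite M" "Poly_Mapping.keys p \<subseteq> M"
  shows "eval_poly v p = (\<Sum>m\<in>M. Poly_Mapping.lookup p m *
    (\<Prod>i\<in>Poly_Mapping.keys m. v i ^ Poly_Mapping.lookup m i))"
  unfolding eval_poly_def using assms
  by (intro sum.mono_neutral_left) (auto simp: in_keys_iff)

lemma eval_poly_diff: "eval_poly v (p - q) = eval_poly v p - eval_poly v q"
proof -
  let ?M = "Poly_Mapping.keys p \<union> Poly_Mapping.keys q"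
  have "finite ?M" "Poly_Mapping.keys (p - q) \<subseteq> ?M"
    using keys_diff[of p q] by auto
  then show ?thesis
    by (simp add: eval_poly_superset[of ?M] lookup_minus left_diff_distrib sum_subtractf)
qed

lemma eval_poly_monomial_pair:
  assumes "i \<noteq> j"
  shows "eval_poly v (monomial (Poly_Mapping.single i s + Poly_Mapping.single j t)) =
    (v i ^ s * v j ^ t :: 'k::comm_ring_1)"
proof -
  let ?m = "Poly_Mapping.single i s + Poly_Mapping.single j t"
  have "Poly_Mapping.keys ?m \<subseteq> {i, j}"
    using keys_add[of "Poly_Mapping.single i s" "Poly_Mapping.single j t"]
    by (auto split: if_splits)
  then have "(\<Prod>l\<in>Poly_Mapping.keys ?m. v l ^ Poly_Mapping.lookup ?m l) =
      (\<Prod>l\<in>{i, j}. v l ^ Poly_Mapping.lookup ?m l)"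
    by (intro monomial_value_superset) auto
  also have "\<dots> = v i ^ s * v j ^ t"
    using assms by (simp add: lookup_add lookup_single)
  finally show ?thesis
    by (simp add: eval_poly_def)
qed

lemma monomial_diff_in_carrier:
  assumes "Poly_Mapping.keys m \<subseteq> {1..r}" "Poly_Mapping.keys n \<subseteq> {1..r}"
  shows "monomial m - monomial n \<in> carrier (poly_ring r :: 'k::comm_ring_1 npoly ring)"
  using keys_diff[of "monomial m :: 'k npoly" "monomial n"] assms
  by (auto simp: poly_ring_def)

lemma homogeneous_monomial_diff:
  assumes "weighted_degree w m = weighted_degree w n"
  shows "homogeneous w (monomial m - monomial n :: 'k::comm_ring_1 npoly)"
  using keys_diff[of "monomial m :: 'k npoly" "monomial n"] assms
  by (auto simp: homogeneous_def)

subsection \<open>Congruence of monomials modulo an ideal\<close>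

text \<open>The ideal laws relative to the carrier are restated with the ordinary operations of the
  polynomial type. \<open>J\<close> is arbitrary here; in the theorem it becomes the ideal generated
  by the binomials.\<close>

locale poly_ideal = ideal J "poly_ring r" for J :: "'k::comm_ring_1 npoly set" and r :: nat
begin

lemma zero_mem: "0 \<in> J"
  using additive_subgroup.zero_closed[OF is_additive_subgroup] by (simp add: poly_ring_def)

lemma add_mem: "p \<in> J \<Longrightarrow> p' \<in> J \<Longrightarrow> p + p' \<in> J"
  using additive_subgroup.a_closed[OF is_additive_subgroup, of p p'] by (simp add: poly_ring_def)

lemma single_mult_mem:
  assumes "p \<in> J" "Poly_Mapping.keys t \<subseteq> {1..r}"
  shows "Poly_Mapping.single t c * p \<in> J"
  using I_l_closed[OF assms(1), of "Poly_Mapping.single t c"] assms(2)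
  by (auto simp: poly_ring_def split: if_splits)

lemma minus_mem: "p \<in> J \<Longrightarrow> - p \<in> J"
  using single_mult_mem[of p 0 "- 1"] by (simp add: single_uminus)

lemma sum_mem: "(\<And>i. i \<in> A \<Longrightarrow> g i \<in> J) \<Longrightarrow> sum g A \<in> J"
  by (induction A rule: infinite_finite_induct) (auto intro: zero_mem add_mem)

definition cong_mon :: "(nat \<Rightarrow>\<^sub>0 nat) \<Rightarrow> (nat \<Rightarrow>\<^sub>0 nat) \<Rightarrow> bool" where
  "cong_mon m n \<longleftrightarrow> monomial m - monomial n \<in> J"

lemma cong_mon_refl: "cong_mon m m"
  by (simp add: cong_mon_def zero_mem)

lemma cong_mon_sym: "cong_mon m n \<Longrightarrow> cong_mon n m"
  unfolding cong_mon_def using minus_mem by fastforce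

lemma cong_mon_trans: "cong_mon l m \<Longrightarrow> cong_mon m n \<Longrightarrow> cong_mon l n"
  unfolding cong_mon_def using add_mem by fastforce

lemma cong_mon_add:
  assumes "cong_mon m n" "Poly_Mapping.keys t \<subseteq> {1..r}"
  shows "cong_mon (t + m) (t + n)"
  using single_mult_mem[OF assms[unfolded cong_mon_def], of 1]
  by (simp add: cong_mon_def right_diff_distrib mult_single)

text \<open>Replacing each monomial by a chosen representative of its \<open>\<rho>\<close>-class
  changes \<open>f\<close> by an element of \<open>J\<close>. The result has the class sums as
  coefficients, so it is zero.\<close>

lemma mem_if_class_sums_0:
  fixes \<rho> :: "(nat \<Rightarrow>\<^sub>0 nat) \<Rightarrow> 'c"
  assumes sums: "\<And>n. n \<in> \<rho> ` Poly_Mapping.keys f \<Longrightarrow>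
      (\<Sum>m\<in>{m \<in> Poly_Mapping.keys f. \<rho> m = n}. Poly_Mapping.lookup f m) = 0"
    and cong: "\<And>m m'. m \<in> Poly_Mapping.keys f \<Longrightarrow> m' \<in> Poly_Mapping.keys f \<Longrightarrow>
      \<rho> m = \<rho> m' \<Longrightarrow> cong_mon m m'"
  shows "f \<in> J"
proof -
  let ?K = "Poly_Mapping.keys f" and ?c = "Poly_Mapping.lookup f"
  define rep where "rep = inv_into ?K \<rho>"
  have rep: "rep (\<rho> m) \<in> ?K" "\<rho> (rep (\<rho> m)) = \<rho> m" if "m \<in> ?K" for m
    using that by (auto simp: rep_def inv_into_into f_inv_into_f)
  have single_sum: "(\<Sum>m\<in>A. Poly_Mapping.single n (?c m)) = Poly_Mapping.single n (sum ?c A)"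
    for A and n :: "nat \<Rightarrow>\<^sub>0 nat"
    by (rule poly_mapping_eqI) (auto simp: lookup_sum lookup_single when_def)
  have "(\<Sum>m\<in>?K. Poly_Mapping.single (rep (\<rho> m)) (?c m)) =
      (\<Sum>n\<in>\<rho> ` ?K. \<Sum>m\<in>{m \<in> ?K. \<rho> m = n}. Poly_Mapping.single (rep (\<rho> m)) (?c m))"
    by (rule sum.image_gen) simp
  also have "\<dots> = (\<Sum>n\<in>\<rho> ` ?K. Poly_Mapping.single (rep n) (\<Sum>m\<in>{m \<in> ?K. \<rho> m = n}. ?c m))"
    by (intro sum.cong refl) (simp flip: single_sum)
  also have "\<dots> = 0"
    by (simp add: sums)
  finally have "f = (\<Sum>m\<in>?K. Poly_Mapping.single m (?c m)) -
      (\<Sum>m\<in>?K. Poly_Mapping.single (rep (\<rho> m)) (?c m))"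
    using poly_mapping_sum_single[of f] by simp
  also have "\<dots> = (\<Sum>m\<in>?K. Poly_Mapping.single 0 (?c m) * (monomial m - monomial (rep (\<rho> m))))"
    by (simp add: sum_subtractf right_diff_distrib mult_single)
  also have "\<dots> \<in> J"
    using cong rep by (intro sum_mem single_mult_mem) (auto simp: cong_mon_def)
  finally show ?thesis .
qed

text \<open>While some \<open>j\<close> other than \<open>k\<close> has exponent at least
  \<open>q\<close>, \<open>step\<close> trades \<open>q - 1\<close> copies of that variable for
  \<open>(q - 1) * w j\<close> copies of the variable \<open>k\<close>. As \<open>k\<close> has
  weight 1, the degree is kept. The total exponent outside \<open>k\<close> drops, so the process
  ends.\<close>

lemma cong_mon_normal_form:
  assumes k: "k \<in> {1..r}" "w k = 1" and q: "2 \<le> q"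
    and step: "\<And>j. j \<in> {1..r} \<Longrightarrow> j \<noteq> k \<Longrightarrow>
      cong_mon (Poly_Mapping.single k 1 + Poly_Mapping.single j q)
        (Poly_Mapping.single k (1 + (q - 1) * w j) + Poly_Mapping.single j 1)"
    and m: "Poly_Mapping.keys m \<subseteq> {1..r}" "0 < Poly_Mapping.lookup m k"
  shows "\<exists>n. cong_mon m n \<and> Poly_Mapping.keys n \<subseteq> {1..r} \<and>
    weighted_degree w n = weighted_degree w m \<and>
    (\<forall>j. j \<noteq> k \<longrightarrow> Poly_Mapping.lookup n j = reduced_exponent q (Poly_Mapping.lookup m j))"
  using m
proof (induction "\<Sum>j\<in>{1..r} - {k}. Poly_Mapping.lookup m j" arbitrary: m rule: less_induct)
  case less
  show ?case
  proof (cases "\<forall>j. j \<noteq> k \<longrightarrow> Poly_Mapping.lookup m j < q")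
    case True
    then have "\<forall>j. j \<noteq> k \<longrightarrow>
        Poly_Mapping.lookup m j = reduced_exponent q (Poly_Mapping.lookup m j)"
      by (simp add: reduced_exponent_id)
    with less.prems show ?thesis
      by (intro exI[of _ m] conjI cong_mon_refl) auto
  next
    case False
    then obtain j where j: "j \<noteq> k" "q \<le> Poly_Mapping.lookup m j"
      by auto
    with q have "j \<in> Poly_Mapping.keys m"
      by (auto simp: in_keys_iff)
    with less.prems have jr: "j \<in> {1..r}"
      by auto
    \<comment> \<open>The cofactor of the left side of \<open>step\<close> in \<open>m\<close>; the
      truncated subtraction is exact because \<open>k\<close> occurs in \<open>m\<close> and
      \<open>j\<close> has exponent at least \<open>q\<close>.\<close>
    define t where "t = m - (Poly_Mapping.single k 1 + Poly_Mapping.single j q)"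
    define m' where "m' = t + (Poly_Mapping.single k (1 + (q - 1) * w j) + Poly_Mapping.single j 1)"
    have m_eq: "m = t + (Poly_Mapping.single k 1 + Poly_Mapping.single j q)"
      using j less.prems(2)
      by (intro poly_mapping_eqI)
        (auto simp: t_def lookup_add lookup_minus lookup_single when_def)
    have t_keys: "Poly_Mapping.keys t \<subseteq> {1..r}"
      using less.prems(1) m_eq by (auto simp: in_keys_iff lookup_add)
    have cong: "cong_mon m m'"
      unfolding m'_def by (subst m_eq) (intro cong_mon_add step jr j(1) t_keys)
    have m'_keys: "Poly_Mapping.keys m' \<subseteq> {1..r}"
    proof
      fix i assume "i \<in> Poly_Mapping.keys m'"
      then have "i \<in> Poly_Mapping.keys t \<or> i = j \<or> i = k"
        by (auto simp: m'_def in_keys_iff lookup_add lookup_single when_def split: if_splits)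
      then show "i \<in> {1..r}"
        using t_keys jr k(1) by blast
    qed
    have wd: "weighted_degree w m' = weighted_degree w m"
    proof -
      have "w j * q = (q - 1) * w j + w j"
        using q by (cases q) auto
      then show ?thesis
        by (subst m_eq) (simp add: m'_def weighted_degree_add weighted_degree_single k(2))
    qed
    have m'_k: "0 < Poly_Mapping.lookup m' k"
      by (simp add: m'_def lookup_add)
    \<comment> \<open>One copy of the variable \<open>j\<close> survives the exchange. This
      positivity is what makes the reduced exponent at \<open>j\<close> invariant, and the factor 1
      fits the form of \<open>reduced_exponent_add\<close>.\<close>
    have m_j: "Poly_Mapping.lookup m j = Poly_Mapping.lookup m' j + (q - 1) * 1"
      and m'_j: "0 < Poly_Mapping.lookup m' j"
      using j q by (simp_all add: m_eq m'_def lookup_add lookup_single)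
    have m'_other: "Poly_Mapping.lookup m' i = Poly_Mapping.lookup m i" if "i \<noteq> j" "i \<noteq> k" for i
      using that by (simp add: m_eq m'_def lookup_add lookup_single)
    have "(\<Sum>i\<in>{1..r} - {k}. Poly_Mapping.lookup m' i) < (\<Sum>i\<in>{1..r} - {k}. Poly_Mapping.lookup m i)"
    proof (rule sum_strict_mono_ex1)
      show "\<forall>i\<in>{1..r} - {k}. Poly_Mapping.lookup m' i \<le> Poly_Mapping.lookup m i"
        using m'_other m_j by (metis DiffD2 le_add1 order_refl singletonI)
      show "\<exists>i\<in>{1..r} - {k}. Poly_Mapping.lookup m' i < Poly_Mapping.lookup m i"
        using j(1) jr m_j q by (intro bexI[of _ j]) auto
    qed simp
    from less.hyps[OF this m'_keys m'_k] obtain n where n: "cong_mon m' n"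
      "Poly_Mapping.keys n \<subseteq> {1..r}" "weighted_degree w n = weighted_degree w m'"
      "\<forall>i. i \<noteq> k \<longrightarrow> Poly_Mapping.lookup n i = reduced_exponent q (Poly_Mapping.lookup m' i)"
      by blast
    have "reduced_exponent q (Poly_Mapping.lookup m' i) = reduced_exponent q (Poly_Mapping.lookup m i)"
      if "i \<noteq> k" for i
      using that m'_other[of i] m_j reduced_exponent_add[OF m'_j, of q 1] by (cases "i = j") simp_all
    with n wd cong show ?thesis
      by (intro exI[of _ n]) (auto intro: cong_mon_trans)
  qed
qed

text \<open>The normal forms of \<open>m\<close> and \<open>n\<close> agree outside
  \<open>k\<close>, since they consist of the reduced exponents there. The common degree then fixes
  the exponent at \<open>k\<close>, whose weight is 1.\<close>

lemma cong_mon_weight_one: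
  assumes k: "k \<in> {1..r}" "w k = 1" and q: "2 \<le> q"
    and step: "\<And>j. j \<in> {1..r} \<Longrightarrow> j \<noteq> k \<Longrightarrow>
      cong_mon (Poly_Mapping.single k 1 + Poly_Mapping.single j q)
        (Poly_Mapping.single k (1 + (q - 1) * w j) + Poly_Mapping.single j 1)"
    and "Poly_Mapping.keys m \<subseteq> {1..r}" "Poly_Mapping.keys n \<subseteq> {1..r}"
    and "0 < Poly_Mapping.lookup m k" "0 < Poly_Mapping.lookup n k"
    and wd: "weighted_degree w m = weighted_degree w n"
    and red: "\<And>i. reduced_exponent q (Poly_Mapping.lookup m i) =
      reduced_exponent q (Poly_Mapping.lookup n i)"
  shows "cong_mon m n"
proof -
  obtain m' where m': "cong_mon m m'" "Poly_Mapping.keys m' \<subseteq> {1..r}"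
    "weighted_degree w m' = weighted_degree w m"
    "\<And>j. j \<noteq> k \<Longrightarrow> Poly_Mapping.lookup m' j = reduced_exponent q (Poly_Mapping.lookup m j)"
    using cong_mon_normal_form[OF k q step assms(5,7)] by blast
  obtain n' where n': "cong_mon n n'" "Poly_Mapping.keys n' \<subseteq> {1..r}"
    "weighted_degree w n' = weighted_degree w n"
    "\<And>j. j \<noteq> k \<Longrightarrow> Poly_Mapping.lookup n' j = reduced_exponent q (Poly_Mapping.lookup n j)"
    using cong_mon_normal_form[OF k q step assms(6,8)] by blast
  have eq: "Poly_Mapping.lookup m' j = Poly_Mapping.lookup n' j" if "j \<noteq> k" for j
    using that m'(4) n'(4) red by simp
  have "(\<Sum>i\<in>{1..r}. w i * Poly_Mapping.lookup m' i) = (\<Sum>i\<in>{1..r}. w i * Poly_Mapping.lookup n' i)"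
    using m'(2,3) n'(2,3) wd weighted_degree_superset[of "{1..r}" _ w] by simp
  moreover have "(\<Sum>i\<in>{1..r} - {k}. w i * Poly_Mapping.lookup m' i) =
      (\<Sum>i\<in>{1..r} - {k}. w i * Poly_Mapping.lookup n' i)"
    using eq by (intro sum.cong) auto
  ultimately have "Poly_Mapping.lookup m' k = Poly_Mapping.lookup n' k"
    unfolding sum.remove[OF finite_atLeastAtMost k(1)] k(2) by simp
  with eq have "m' = n'"
    by (intro poly_mapping_eqI) metis
  with m'(1) n'(1) show ?thesis
    by (auto intro: cong_mon_trans cong_mon_sym)
qed

text \<open>The congruence \<open>gen\<close> is applied \<open>c\<close> times, each time trading
  \<open>s\<close> copies of \<open>y\<close> for \<open>t\<close> copies of \<open>z\<close>.
  Positive \<open>e\<close> and \<open>f\<close> supply the one copy of each variable that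
  \<open>gen\<close> carries along. Since the exponent of \<open>z\<close> grows, \<open>f\<close>
  varies in the induction.\<close>

lemma cong_mon_two_variables:
  assumes gen: "cong_mon (Poly_Mapping.single y (1 + s) + Poly_Mapping.single z 1)
      (Poly_Mapping.single y 1 + Poly_Mapping.single z (1 + t))"
    and yz: "y \<in> {1..r}" "z \<in> {1..r}"
    and "0 < e" "0 < f"
  shows "cong_mon (Poly_Mapping.single y (e + s * c) + Poly_Mapping.single z f)
    (Poly_Mapping.single y e + Poly_Mapping.single z (f + t * c))"
  using \<open>0 < f\<close>
proof (induction c arbitrary: f)
  case 0
  then show ?case by (simp add: cong_mon_refl)
next
  case (Suc c)
  \<comment> \<open>The cofactor of \<open>gen\<close> in the current monomial, with one copy of
    each variable removed.\<close>
  let ?t = "Poly_Mapping.single y (e - 1 + s * c) + Poly_Mapping.single z (f - 1)"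
  have "Poly_Mapping.keys ?t \<subseteq> {1..r}"
    using yz by (auto simp: in_keys_iff lookup_add lookup_single when_def split: if_splits)
  from cong_mon_add[OF gen this]
  have "cong_mon (?t + (Poly_Mapping.single y (1 + s) + Poly_Mapping.single z 1))
    (?t + (Poly_Mapping.single y 1 + Poly_Mapping.single z (1 + t)))" .
  also have "?t + (Poly_Mapping.single y (1 + s) + Poly_Mapping.single z 1) =
      Poly_Mapping.single y (e + s * Suc c) + Poly_Mapping.single z f"
    using Suc.prems \<open>0 < e\<close>
    by (intro poly_mapping_eqI) (auto simp: lookup_add lookup_single when_def)
  also have "?t + (Poly_Mapping.single y 1 + Poly_Mapping.single z (1 + t)) =
      Poly_Mapping.single y (e + s * c) + Poly_Mapping.single z (f + t)"
    using Suc.prems \<open>0 < e\<close>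
    by (intro poly_mapping_eqI) (auto simp: lookup_add lookup_single when_def)
  finally have "cong_mon (Poly_Mapping.single y (e + s * Suc c) + Poly_Mapping.single z f)
      (Poly_Mapping.single y (e + s * c) + Poly_Mapping.single z (f + t))" .
  moreover have "cong_mon (Poly_Mapping.single y (e + s * c) + Poly_Mapping.single z (f + t))
      (Poly_Mapping.single y e + Poly_Mapping.single z (f + t * Suc c))"
    using Suc.IH[of "f + t"] Suc.prems by (simp add: add.assoc)
  ultimately show ?case
    by (rule cong_mon_trans)
qed

end

subsection \<open>Vanishing homogeneous polynomials\<close>

lemma eval_poly_atLeastAtMost:
  assumes "p \<in> carrier (poly_ring r :: 'k::comm_ring_1 npoly ring)"
  shows "eval_poly v p = (\<Sum>m\<in>Poly_Mapping.keys p. Poly_Mapping.lookup p m *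
    (\<Prod>i\<in>{1..r}. v i ^ Poly_Mapping.lookup m i))"
  unfolding eval_poly_def
proof (intro sum.cong refl)
  fix m assume "m \<in> Poly_Mapping.keys p"
  then have "Poly_Mapping.keys m \<subseteq> {1..r}"
    using assms by (auto simp: poly_ring_def)
  then show "Poly_Mapping.lookup p m * (\<Prod>i\<in>Poly_Mapping.keys m. v i ^ Poly_Mapping.lookup m i) =
      Poly_Mapping.lookup p m * (\<Prod>i\<in>{1..r}. v i ^ Poly_Mapping.lookup m i)"
    by (simp only: monomial_value_superset[of "{1..r}"] finite_atLeastAtMost)
qed

text \<open>Only the origin has to be added. As the weights are positive, a homogeneous polynomial
  with a constant term is a constant, and a nonzero constant does not vanish at the point with all
  coordinates 1. So there is no constant term, and every other monomial is zero at the
  origin.\<close>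

lemma homogeneous_vanishing_everywhere:
  fixes p :: "'k::field npoly"
  assumes p: "p \<in> carrier (poly_ring r)" and hom: "homogeneous w p"
    and vanish: "\<And>v. v \<in> nonzero_points r \<Longrightarrow> eval_poly v p = 0"
    and r: "1 \<le> r" and w: "\<And>i. i \<in> {1..r} \<Longrightarrow> 0 < w i"
  shows "eval_poly v p = 0"
proof (cases "\<exists>i\<in>{1..r}. v i \<noteq> 0")
  case True
  then obtain i where i: "i \<in> {1..r}" "v i \<noteq> 0"
    by blast
  \<comment> \<open>Members of \<open>nonzero_points r\<close> are extensional, whereas
    \<open>v\<close> is arbitrary outside \<open>{1..r}\<close>; evaluation of \<open>p\<close> does
    not see the difference.\<close>
  define u where "u = restrict v {1..r}"
  have "u i \<noteq> (\<lambda>i\<in>{1..r}. 0) i"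
    using i by (simp add: u_def)
  then have "u \<noteq> (\<lambda>i\<in>{1..r}. 0)"
    by metis
  then have "u \<in> nonzero_points r"
    by (simp add: nonzero_points_def u_def)
  then have "eval_poly u p = 0"
    by (rule vanish)
  moreover have "eval_poly u p = eval_poly v p"
    unfolding eval_poly_atLeastAtMost[OF p]
    by (intro sum.cong prod.cong refl arg_cong2[of _ _ _ _ "(*)"]) (simp add: u_def)
  ultimately show ?thesis by simp
next
  case False
  have keys: "Poly_Mapping.keys m \<subseteq> {1..r}" if "m \<in> Poly_Mapping.keys p" for m
    using p that by (auto simp: poly_ring_def)
  have "0 \<notin> Poly_Mapping.keys p"
  proof
    assume 0: "0 \<in> Poly_Mapping.keys p"
    have "m = 0" if m: "m \<in> Poly_Mapping.keys p" for m
    proof -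
      from hom obtain d where "\<forall>m\<in>Poly_Mapping.keys p. weighted_degree w m = d"
        unfolding homogeneous_def by blast
      then have "weighted_degree w m = 0"
        using m 0 by (metis Poly_Mapping.keys_zero sum.empty weighted_degree_def)
      then have "w i * Poly_Mapping.lookup m i = 0" if "i \<in> Poly_Mapping.keys m" for i
        using that by (simp add: weighted_degree_def)
      moreover have "0 < w i" if "i \<in> Poly_Mapping.keys m" for i
        using w keys[OF m] that by blast
      ultimately have "Poly_Mapping.keys m = {}"
        by (fastforce simp: in_keys_iff)
      then show ?thesis by simp
    qed
    with 0 have "Poly_Mapping.keys p = {0}"
      by blast
    then have "eval_poly u p = Poly_Mapping.lookup p 0" for u
      by (simp add: eval_poly_def)
    moreover define u :: "nat \<Rightarrow> 'k" where "u = (\<lambda>i\<in>{1..r}. 1)"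
    have "u 1 \<noteq> (\<lambda>i\<in>{1..r}. 0) 1"
      using r by (simp add: u_def)
    then have "u \<noteq> (\<lambda>i\<in>{1..r}. 0)"
      by metis
    then have "u \<in> nonzero_points r"
      by (simp add: nonzero_points_def u_def)
    ultimately have "Poly_Mapping.lookup p 0 = 0"
      using vanish by metis
    with 0 show False
      by (simp add: in_keys_iff)
  qed
  moreover have "(\<Prod>i\<in>Poly_Mapping.keys m. v i ^ Poly_Mapping.lookup m i) = 0"
    if m: "m \<in> Poly_Mapping.keys p" "m \<noteq> 0" for m
  proof -
    from m(2) obtain i where i: "i \<in> Poly_Mapping.keys m"
      by fastforce
    then have "v i = 0"
      using keys[OF m(1)] False by blast
    with i show ?thesis
      by (intro prod_zero) (auto simp: in_keys_iff intro!: bexI[of _ i])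
  qed
  ultimately show ?thesis
    unfolding eval_poly_def by (intro sum.neutral) (metis mult_zero_right)
qed

text \<open>As a function, \<open>p\<close> equals the combination of reduced monomials whose
  coefficients are these class sums, and distinct reduced monomials are independent.\<close>

lemma reduced_class_sums_eq_0:
  fixes p :: "'k::{field,finite} npoly"
  defines "\<rho> m \<equiv> \<lambda>i. reduced_exponent (CARD('k)) (Poly_Mapping.lookup m i)"
  assumes p: "p \<in> carrier (poly_ring r)" and vanish: "\<And>v. eval_poly v p = 0"
    and n: "n \<in> \<rho> ` Poly_Mapping.keys p"
  shows "(\<Sum>m\<in>{m \<in> Poly_Mapping.keys p. \<rho> m = n}. Poly_Mapping.lookup p m) = 0"
proof (rule reduced_monomials_independent[where I = "{1..r}" and
      M = "\<rho> ` Poly_Mapping.keys p" and e = "\<lambda>n. n" and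
      c = "\<lambda>n. \<Sum>m\<in>{m \<in> Poly_Mapping.keys p. \<rho> m = n}. Poly_Mapping.lookup p m"])
  fix n n' assume n: "n \<in> \<rho> ` Poly_Mapping.keys p" "n' \<in> \<rho> ` Poly_Mapping.keys p"
    and eq: "\<And>i. i \<in> {1..r} \<Longrightarrow> n i = n' i"
  \<comment> \<open>Classes are functions on all natural numbers, so agreement on
    \<open>{1..r}\<close> gives equality only once their values outside are known.\<close>
  have "k i = 0" if "k \<in> \<rho> ` Poly_Mapping.keys p" "i \<notin> {1..r}" for k i
  proof -
    from that(1) obtain m where m: "m \<in> Poly_Mapping.keys p" "k = \<rho> m"
      by blast
    with p have "Poly_Mapping.keys m \<subseteq> {1..r}"
      by (auto simp: poly_ring_def)
    with that(2) have "Poly_Mapping.lookup m i = 0"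
      by (metis in_keys_iff subsetD)
    with m show ?thesis
      by (simp add: \<rho>_def reduced_exponent_0_iff)
  qed
  with n eq show "n = n'"
    by (metis ext)
next
  fix n i assume "n \<in> \<rho> ` Poly_Mapping.keys p"
  then show "n i < CARD('k)"
    using reduced_exponent_less[OF two_le_card_field] by (auto simp: \<rho>_def)
next
  fix v :: "nat \<Rightarrow> 'k"
  let ?K = "Poly_Mapping.keys p"
  have "(\<Sum>n\<in>\<rho> ` ?K. (\<Sum>m\<in>{m \<in> ?K. \<rho> m = n}. Poly_Mapping.lookup p m) * (\<Prod>i\<in>{1..r}. v i ^ n i)) =
      (\<Sum>n\<in>\<rho> ` ?K. \<Sum>m\<in>{m \<in> ?K. \<rho> m = n}. Poly_Mapping.lookup p m * (\<Prod>i\<in>{1..r}. v i ^ \<rho> m i))"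
    by (intro sum.cong refl) (simp add: sum_distrib_right)
  also have "\<dots> = (\<Sum>m\<in>?K. Poly_Mapping.lookup p m * (\<Prod>i\<in>{1..r}. v i ^ \<rho> m i))"
    by (rule sum.image_gen[symmetric]) simp
  also have "\<dots> = eval_poly v p"
    by (simp add: eval_poly_atLeastAtMost[OF p] \<rho>_def power_reduced_exponent)
  finally show "(\<Sum>n\<in>\<rho> ` ?K. (\<Sum>m\<in>{m \<in> ?K. \<rho> m = n}. Poly_Mapping.lookup p m) *
      (\<Prod>i\<in>{1..r}. v i ^ n i)) = 0"
    using vanish by simp
qed (use n in simp_all)

text \<open>Since \<open>x ^ (1 + (q - 1) * e) = x\<close> on the whole field, both monomials take
  the value \<open>v i * v j\<close>. The condition on \<open>w\<close> makes their degrees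
  equal.\<close>

lemma binomial_in_vanishing_set:
  fixes i j r s t :: nat and w :: "nat \<Rightarrow> nat"
  defines "g \<equiv> var i * var j * (var i ^ ((CARD('k) - 1) * s) - var j ^ ((CARD('k) - 1) * t))
    :: 'k::{field,finite} npoly"
  assumes ij: "i \<in> {1..r}" "j \<in> {1..r}" "i \<noteq> j"
    and wd: "w i * s = w j * t" and pos: "0 < s" "0 < t"
  shows "g \<in> {p \<in> carrier (poly_ring r). homogeneous w p \<and> (\<forall>v\<in>nonzero_points r. eval_poly v p = 0)}"
proof -
  let ?q = "CARD('k) - 1"
  let ?m = "Poly_Mapping.single i (Suc (?q * s)) + Poly_Mapping.single j 1"
  let ?n = "Poly_Mapping.single i 1 + Poly_Mapping.single j (Suc (?q * t))"
  have g: "g = monomial ?m - monomial ?n"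
    unfolding g_def by (rule binomial_eq)
  have "Poly_Mapping.keys ?m \<subseteq> {1..r}" "Poly_Mapping.keys ?n \<subseteq> {1..r}"
    using ij by (auto simp: in_keys_iff lookup_add lookup_single when_def split: if_splits)
  then have "g \<in> carrier (poly_ring r)"
    unfolding g by (rule monomial_diff_in_carrier)
  moreover have "w i * (?q * s) = w j * (?q * t)"
    using wd by (metis mult.left_commute)
  then have "homogeneous w g"
    unfolding g
    by (intro homogeneous_monomial_diff) (simp add: weighted_degree_add weighted_degree_single)
  moreover have "eval_poly v g = 0" for v
  proof -
    have *: "x ^ Suc (?q * e) = x" for x :: 'k and e
      using finite_field_power_card_minus_1[of x]
      by (cases "x = 0") (simp_all add: power_mult del: One_nat_def)
    show ?thesis
      by (simp only: g eval_poly_diff eval_poly_monomial_pair[OF ij(3)] * power_one_right diff_self)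
  qed
  ultimately show ?thesis by blast
qed

theorem theorem5p7:
  fixes r a b q :: nat and w :: "nat \<Rightarrow> nat"
  assumes "q = CARD('k::{field, finite})"
    and "r \<ge> 3"
    and "well_formed_weights r w"
    and "\<And>i. i \<in> {1..r - 2} \<Longrightarrow> w i = 1"
    and "w (r - 1) = a"
    and "w r = b"
    and "coprime a b"
  shows "(vanishing_ideal r w :: 'k npoly set) =
    Idl\<^bsub>poly_ring r\<^esub>
      ({var i * var j * (var i ^ (q - 1) - var j ^ (q - 1)) | i j. 1 \<le> i \<and> i < j \<and> j < r - 1}
       \<union> {var k * var (r - 1) * (var k ^ ((q - 1) * a) - var (r - 1) ^ (q - 1)) | k.
            1 \<le> k \<and> k < r - 1}
       \<union> {var k * var r * (var k ^ ((q - 1) * b) - var r ^ (q - 1)) | k. 1 \<le> k \<and> k < r - 1}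
       \<union> {var (r - 1) * var r * (var (r - 1) ^ ((q - 1) * b) - var r ^ ((q - 1) * a))})"
    (is "_ = Idl\<^bsub>_\<^esub> ?B")
proof -
  let ?R = "poly_ring r :: 'k npoly ring"
  let ?V = "{p \<in> carrier ?R. homogeneous w p \<and> (\<forall>v \<in> nonzero_points r. eval_poly v p = 0)}"
  define J where "J = Idl\<^bsub>?R\<^esub> ?B"
  interpret cring ?R
    by (rule poly_ring_cring)
  have w_pos: "0 < w i" if "i \<in> {1..r}" for i
    using assms(3) that by (simp add: well_formed_weights_def)
  have ab: "0 < a" "0 < b"
    using w_pos[of "r - 1"] w_pos[of r] assms(2,5,6) by simp_all
  have w1: "w k = 1" if "1 \<le> k" "k < r - 1" for k
    using assms(4)[of k] that by simp
  have q: "2 \<le> q"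
    unfolding assms(1) by (rule two_le_card_field)

  \<comment> \<open>The binomials are homogeneous and vanish at all rational points\<close>
  have B_V: "?B \<subseteq> ?V"
  proof -
    \<comment> \<open>The four families are the cases where \<open>(s, t)\<close> is
      \<open>(1, 1)\<close>, \<open>(a, 1)\<close>, \<open>(b, 1)\<close> and
      \<open>(b, a)\<close>.\<close>
    have *: "var i * var j * (var i ^ ((q - 1) * s) - var j ^ ((q - 1) * t)) \<in> ?V"
      if "i \<in> {1..r}" "j \<in> {1..r}" "i \<noteq> j" "w i * s = w j * t" "0 < s" "0 < t" for i j s t
      using binomial_in_vanishing_set[OF that, where 'k = 'k] unfolding assms(1) .
    have "var i * var j * (var i ^ (q - 1) - var j ^ (q - 1)) \<in> ?V"
      if "1 \<le> i" "i < j" "j < r - 1" for i j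
      using *[of i j 1 1] that w1[of i] w1[of j] unfolding mult_1_right by simp
    moreover have "var k * var (r - 1) * (var k ^ ((q - 1) * a) - var (r - 1) ^ (q - 1)) \<in> ?V"
      if "1 \<le> k" "k < r - 1" for k
      using *[of k "r - 1" a 1] that w1[of k] ab assms(5) unfolding mult_1_right by simp
    moreover have "var k * var r * (var k ^ ((q - 1) * b) - var r ^ (q - 1)) \<in> ?V"
      if "1 \<le> k" "k < r - 1" for k
      using *[of k r b 1] that w1[of k] ab assms(6) unfolding mult_1_right by simp
    moreover have "var (r - 1) * var r * (var (r - 1) ^ ((q - 1) * b) - var r ^ ((q - 1) * a)) \<in> ?V"
      using assms(2) ab by (intro *) (auto simp: assms(5,6)[unfolded One_nat_def])
    ultimately show ?thesis
      by blast
  qed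
  have B_carrier: "?B \<subseteq> carrier ?R"
    by (rule order_trans[OF B_V]) blast
  have B_J: "?B \<subseteq> J"
    unfolding J_def by (rule genideal_self[OF B_carrier])
  interpret poly_ideal J r
    unfolding poly_ideal_def J_def by (rule genideal_ideal[OF B_carrier])
  \<comment> \<open>The first three families in one uniform form, with \<open>k\<close> of weight 1.
    The first family lists each pair in increasing order only, hence separate cases for
    \<open>k < j\<close> and \<open>j < k\<close>.\<close>
  have step: "cong_mon (Poly_Mapping.single k 1 + Poly_Mapping.single j q)
      (Poly_Mapping.single k (1 + (q - 1) * w j) + Poly_Mapping.single j 1)"
    if k: "1 \<le> k" "k < r - 1" and j: "j \<in> {1..r}" "j \<noteq> k" for j k
  proof -
    have gen: "cong_mon (Poly_Mapping.single i (1 + s) + Poly_Mapping.single l 1)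
        (Poly_Mapping.single i 1 + Poly_Mapping.single l (1 + t))"
      if "var i * var l * (var i ^ s - var l ^ t) \<in> ?B" for i l s t
      using subsetD[OF B_J that] by (simp add: cong_mon_def binomial_eq)
    have Suc_q: "1 + (q - 1) = q" and Suc_q': "Suc (q - Suc 0) = q"
      using q by simp_all
    consider "k < j" "j < r - 1" | "j < k" | "j = r - 1" | "j = r"
      using j by fastforce
    then show ?thesis
    proof cases
      case 1
      with k have "var k * var j * (var k ^ (q - 1) - var j ^ (q - 1)) \<in> ?B"
        by blast
      then show ?thesis
        using gen[of k j "q - 1" "q - 1"] w1[of j] 1 k unfolding Suc_q by (simp add: Suc_q' cong_mon_sym)
    next
      case 2
      with k j have "var j * var k * (var j ^ (q - 1) - var k ^ (q - 1)) \<in> ?B"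
        by auto
      then show ?thesis
        using gen[of j k "q - 1" "q - 1"] w1[of j] 2 k j unfolding Suc_q
        by (simp add: Suc_q' add.commute)
    next
      case 3
      from k have "var k * var (r - 1) * (var k ^ ((q - 1) * a) - var (r - 1) ^ (q - 1)) \<in> ?B"
        by blast
      then show ?thesis
        using gen[of k "r - 1" "(q - 1) * a" "q - 1"] assms(5) unfolding Suc_q 3
        by (simp add: cong_mon_sym)
    next
      case 4
      from k have "var k * var r * (var k ^ ((q - 1) * b) - var r ^ (q - 1)) \<in> ?B"
        by blast
      then show ?thesis
        using gen[of k r "(q - 1) * b" "q - 1"] assms(6) unfolding Suc_q 4
        by (simp add: cong_mon_sym)
    qed
  qed
  have pair: "cong_mon (Poly_Mapping.single (r - 1) (1 + (q - 1) * b) + Poly_Mapping.single r 1)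
      (Poly_Mapping.single (r - 1) 1 + Poly_Mapping.single r (1 + (q - 1) * a))"
    using B_J by (simp add: cong_mon_def binomial_eq)

  \<comment> \<open>Monomials of equal degree and equal reduced exponents are congruent\<close>
  have cong: "cong_mon m n"
    if m: "Poly_Mapping.keys m \<subseteq> {1..r}" and n: "Poly_Mapping.keys n \<subseteq> {1..r}"
      and wd: "weighted_degree w m = weighted_degree w n"
      and red: "\<And>i. reduced_exponent q (Poly_Mapping.lookup m i) =
        reduced_exponent q (Poly_Mapping.lookup n i)" for m n
  proof (cases "\<exists>k. 1 \<le> k \<and> k < r - 1 \<and> 0 < Poly_Mapping.lookup m k")
    case True
    then obtain k where k: "1 \<le> k" "k < r - 1" "0 < Poly_Mapping.lookup m k"
      by blast
    \<comment> \<open>Reduced exponents vanish exactly at the absent variables, so \<open>m\<close>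
      and \<open>n\<close> have the same support.\<close>
    then have "0 < Poly_Mapping.lookup n k"
      using red[of k] by (metis reduced_exponent_0_iff gr0I less_irrefl)
    then show ?thesis
      using k w1[of k] q step m n wd red by (intro cong_mon_weight_one[of k w q m n]) auto
  next
    case False
    let ?y = "r - 1"
    have supp: "l = Poly_Mapping.single ?y (Poly_Mapping.lookup l ?y)
        + Poly_Mapping.single r (Poly_Mapping.lookup l r)"
      if "Poly_Mapping.keys l \<subseteq> {1..r}" "\<And>k. 1 \<le> k \<Longrightarrow> k < r - 1 \<Longrightarrow> Poly_Mapping.lookup l k = 0" for l
    proof (rule poly_mapping_eqI)
      fix i
      have "Poly_Mapping.lookup l i = 0" if "i \<noteq> ?y" "i \<noteq> r"
      proof (cases "i \<in> {1..r}")
        case True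
        with \<open>i \<noteq> ?y\<close> \<open>i \<noteq> r\<close> show ?thesis
          by (intro \<open>\<And>k. 1 \<le> k \<Longrightarrow> k < r - 1 \<Longrightarrow> Poly_Mapping.lookup l k = 0\<close>) auto
      next
        case False
        then show ?thesis
          using \<open>Poly_Mapping.keys l \<subseteq> {1..r}\<close> by (metis in_keys_iff subsetD)
      qed
      then show "Poly_Mapping.lookup l i = Poly_Mapping.lookup (Poly_Mapping.single ?y
          (Poly_Mapping.lookup l ?y) + Poly_Mapping.single r (Poly_Mapping.lookup l r)) i"
        using assms(2) by (auto simp: lookup_add lookup_single when_def)
    qed
    \<comment> \<open>With \<open>y' \<le> y\<close>, equality of degrees forces
      \<open>z \<le> z'\<close>. The differences are \<open>(q - 1) * u\<close> and
      \<open>(q - 1) * v\<close> with \<open>a * u = b * v\<close>; coprimality yields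
      \<open>u = b * c\<close> and \<open>v = a * c\<close>, which amounts to \<open>c\<close> uses
      of \<open>pair\<close>.\<close>
    have descend: "cong_mon m n"
      if m: "m = Poly_Mapping.single ?y y + Poly_Mapping.single r z"
        and n: "n = Poly_Mapping.single ?y y' + Poly_Mapping.single r z'"
        and wd: "a * y + b * z = a * y' + b * z'"
        and red: "reduced_exponent q y = reduced_exponent q y'"
          "reduced_exponent q z = reduced_exponent q z'"
        and le: "y' \<le> y" for m n y y' z z'
    proof -
      have "a * y' \<le> a * y"
        using le by simp
      with wd ab have z_le: "z \<le> z'"
        by (metis add_le_cancel_left add_le_cancel_right le_trans mult_le_cancel1 order_refl)
      from red(1) le obtain u where u: "y = y' + (q - 1) * u"
        by (rule reduced_exponent_eqD)
      from red(2)[symmetric] z_le obtain v where v: "z' = z + (q - 1) * v"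
        by (rule reduced_exponent_eqD)
      have "(q - 1) * (a * u) = (q - 1) * (b * v)"
        using wd unfolding u v by (simp add: algebra_simps)
      then have uv: "a * u = b * v"
        using q by simp
      then have "b dvd u"
        using assms(7) by (metis coprime_commute coprime_dvd_mult_right_iff dvd_triv_left)
      then obtain c where c: "u = b * c"
        by blast
      with uv ab have v_eq: "v = a * c"
        by simp
      show ?thesis
      \<comment> \<open>If \<open>y'\<close> or \<open>z\<close> is zero, the binomial cannot be
        applied. But then its counterpart \<open>y\<close> or \<open>z'\<close> is zero too, having
        the same reduced exponent, and the degree determines the remaining exponent.\<close>
      proof (cases "c = 0 \<or> y' = 0 \<or> z = 0")
        case True
        then have "y = y' \<and> z = z'"
          using u v c v_eq red wd ab by (auto simp: reduced_exponent_0_iff reduced_exponent_def split: if_splits)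
        then show ?thesis
          using m n cong_mon_refl by simp
      next
        case False
        then have "cong_mon (Poly_Mapping.single ?y (y' + (q - 1) * b * c) + Poly_Mapping.single r z)
            (Poly_Mapping.single ?y y' + Poly_Mapping.single r (z + (q - 1) * a * c))"
          using assms(2) pair by (intro cong_mon_two_variables) auto
        then show ?thesis
          by (simp only: m n u v c v_eq mult.assoc)
      qed
    qed
    have m0: "Poly_Mapping.lookup m k = 0" if "1 \<le> k" "k < r - 1" for k
      using False that by auto
    have n0: "Poly_Mapping.lookup n k = 0" if "1 \<le> k" "k < r - 1" for k
      using red[of k] m0[OF that] reduced_exponent_0_iff by metis
    have m_eq: "m = Poly_Mapping.single ?y (Poly_Mapping.lookup m ?y)
        + Poly_Mapping.single r (Poly_Mapping.lookup m r)"
      by (rule supp[OF m m0])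
    have n_eq: "n = Poly_Mapping.single ?y (Poly_Mapping.lookup n ?y)
        + Poly_Mapping.single r (Poly_Mapping.lookup n r)"
      by (rule supp[OF n n0])
    have wd_eq: "weighted_degree w l = a * y + b * z"
      if "l = Poly_Mapping.single ?y y + Poly_Mapping.single r z" for l y z
      by (simp only: that weighted_degree_add weighted_degree_single assms(5,6))
    have wd': "a * Poly_Mapping.lookup m ?y + b * Poly_Mapping.lookup m r =
        a * Poly_Mapping.lookup n ?y + b * Poly_Mapping.lookup n r"
      using wd wd_eq[OF m_eq] wd_eq[OF n_eq] by simp
    show ?thesis
    proof (cases "Poly_Mapping.lookup n ?y \<le> Poly_Mapping.lookup m ?y")
      case True
      then show ?thesis
        by (rule descend[OF m_eq n_eq wd' red red])
    next
      case False
      then have "Poly_Mapping.lookup m ?y \<le> Poly_Mapping.lookup n ?y"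
        by simp
      then show ?thesis
        by (rule cong_mon_sym[OF descend[OF n_eq m_eq wd'[symmetric] red[symmetric] red[symmetric]]])
    qed
  qed

  \<comment> \<open>Vanishing homogeneous polynomials lie in the ideal of the binomials\<close>
  have "?V \<subseteq> J"
  proof
    fix p assume "p \<in> ?V"
    then have p: "p \<in> carrier ?R" "homogeneous w p" "\<And>v. v \<in> nonzero_points r \<Longrightarrow> eval_poly v p = 0"
      by auto
    have zero: "eval_poly v p = 0" for v
      using assms(2) w_pos by (intro homogeneous_vanishing_everywhere[OF p]) auto
    show "p \<in> J"
    \<comment> \<open>Classes are formed by reduced exponents alone; the equality of degrees
      required by \<open>cong\<close> comes from the homogeneity of \<open>p\<close>.\<close>
    proof (rule mem_if_class_sums_0[OF reduced_class_sums_eq_0[OF p(1) zero]])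
      fix m n assume mn: "m \<in> Poly_Mapping.keys p" "n \<in> Poly_Mapping.keys p"
        and "(\<lambda>i. reduced_exponent CARD('k) (Poly_Mapping.lookup m i)) =
          (\<lambda>i. reduced_exponent CARD('k) (Poly_Mapping.lookup n i))"
      then have "reduced_exponent q (Poly_Mapping.lookup m i) =
          reduced_exponent q (Poly_Mapping.lookup n i)" for i
        unfolding assms(1) by metis
      moreover have "weighted_degree w m = weighted_degree w n"
        using p(2) mn unfolding homogeneous_def by metis
      moreover have "Poly_Mapping.keys m \<subseteq> {1..r}" "Poly_Mapping.keys n \<subseteq> {1..r}"
        using p(1) mn by (auto simp: poly_ring_def)
      ultimately show "cong_mon m n"
        by (intro cong)
    qed
  qed
  then have "Idl\<^bsub>?R\<^esub> ?V \<subseteq> J"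
    by (intro genideal_minimal is_ideal)
  moreover have "J \<subseteq> Idl\<^bsub>?R\<^esub> ?V"
    unfolding J_def
    by (intro genideal_minimal genideal_ideal order_trans[OF B_V genideal_self]) blast+
  ultimately show ?thesis
    unfolding vanishing_ideal_def J_def by blast
qed

end
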